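(* Let $A$ be a g-alternative algebra over a field $F$. Suppose that for all $b_1,b_2,b_3\in\mathfrak{B}(A)$ and all $a\in A$ the following eleven equalities hold: (1) $b_1(b_2(b_3a))+b_1(b_2(ab_3))=0$; (2) $b_1((ab_2)b_3)+b_1((b_2a)b_3)=0$; (3) $((b_1a)b_2)b_3+(b_2(b_1a))b_3=0$; (4) $b_1(b_2(ab_3))+b_2(b_1(ab_3))=0$; (5) $((b_1a)b_2)b_3+((b_2a)b_1)b_3=0$; (6) $b_1(b_2(b_3a))+b_1((b_3a)b_2)=0$; (7) $b_1(b_2(ab_3))+b_1((ab_3)b_2)=0$; (8) $(b_1(b_2a))b_3+(b_1(ab_2))b_3=0$; (9) $((ab_1)b_2)b_3+(b_2(ab_1))b_3=0$; (10) $((ab_3)b_1)b_2+((ab_3)b_2)b_1=0$; (11) $b_3(b_2(ab_1))+b_3(b_1(ab_2))=0$. Then $\mathfrak{B}(A)$ is a g-alternative algebra.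
   Context: Algebras: an algebra over a field $F$ is an $F$-vector space with an $F$-bilinear multiplication, not assumed associative or unital. $A$ is g-alternative if for all $x,y,z\in A$: $x(yz)=(xy)z+(yx)z-y(xz)$ and $(xy)z=x(yz)+x(zy)-(xz)y$. Derived actions: a derived action in $\mathrm{gAlt}$ (the category of g-alternative algebras over $F$) of a g-alternative algebra $B$ on a g-alternative algebra $A$ is a pair of $F$-bilinear maps $B\times A\to A$, $(b,a)\mapsto ba$, and $A\times B\to A$, $(a,b)\mapsto ab$, such that for all $a,a_1,a_2\in A$, $b,b_1,b_2\in B$: $b(a_1a_2)=(ba_1)a_2+(a_1b)a_2-a_1(ba_2)$; $(a_1a_2)b=a_1(a_2b)+a_1(ba_2)-(a_1b)a_2$; $(ba_1)a_2=b(a_1a_2)+b(a_2a_1)-(ba_2)a_1$; $a_1(a_2b)=(a_1a_2)b+(a_2a_1)b-a_2(a_1b)$; $(b_1b_2)a=b_1(b_2a)+b_1(ab_2)-(b_1a)b_2$; $a(b_1b_2)=(ab_1)b_2+(b_1a)b_2-b_1(ab_2)$; $(ab_1)b_2=a(b_1b_2)+a(b_2b_1)-(ab_2)b_1$; $b_1(b_2a)=(b_1b_2)a+(b_2b_1)a-b_2(b_1a)$. Let $\{B_i\}_{i\in I}$ be the family of all g-alternative algebras equipped with a derived action on $A$ in $\mathrm{gAlt}$. $\mathfrak{B}(A)$: for a pair $f$ of $F$-linear maps $A\to A$ write $fa$ for the value of the first map at $a$ and $af$ for the value of the second. Each $b\in B_i$ gives the pair $(a\mapsto ba,\ a\mapsto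 ab)$; let $\mathbb{B}$ be the set of all pairs so obtained. On pairs define addition componentwise and a product $ff'$ by $(ff')a=f(f'a)+f(af')-(fa)f'$, $a(ff')=(af)f'+(fa)f'-f(af')$. Then $\mathfrak{B}(A)$ (the universal strict general actor of $A$) is the $F$-algebra of all pairs obtained from elements of $\mathbb{B}$ by repeatedly applying addition, negation and this product (pairs giving the same maps are identified). It acts on $A$ by $(f,a)\mapsto fa$, $(a,f)\mapsto af$. *)

theory Defs
  imports "HOL-Algebra.Module"
begin

section \<open>Algebras over a field\<close>

definition bilinear_map ::
  "('f, 'm) ring_scheme \<Rightarrow> ('f, 'u, 'k) module_scheme \<Rightarrow> ('f, 'v, 'l) module_scheme
    \<Rightarrow> ('f, 'w, 'n) module_scheme \<Rightarrow> ('u \<Rightarrow> 'v \<Rightarrow> 'w) \<Rightarrow> bool"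
  where "bilinear_map F U V W \<beta> \<longleftrightarrow>
    (\<forall>u\<in>carrier U. \<forall>v\<in>carrier V. \<beta> u v \<in> carrier W) \<and>
    (\<forall>u\<in>carrier U. \<forall>u'\<in>carrier U. \<forall>v\<in>carrier V.
      \<beta> (u \<oplus>\<^bsub>U\<^esub> u') v = \<beta> u v \<oplus>\<^bsub>W\<^esub> \<beta> u' v) \<and>
    (\<forall>u\<in>carrier U. \<forall>v\<in>carrier V. \<forall>v'\<in>carrier V.
      \<beta> u (v \<oplus>\<^bsub>V\<^esub> v') = \<beta> u v \<oplus>\<^bsub>W\<^esub> \<beta> u v') \<and>
    (\<forall>c\<in>carrier F. \<forall>u\<in>carrier U. \<forall>v\<in>carrier V.
      \<beta> (c \<odot>\<^bsub>U\<^esub> u) v = c \<odot>\<^bsub>W\<^esub> \<beta> u v) \<and>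
    (\<forall>c\<in>carrier F. \<forall>u\<in>carrier U. \<forall>v\<in>carrier V.
      \<beta> u (c \<odot>\<^bsub>V\<^esub> v) = c \<odot>\<^bsub>W\<^esub> \<beta> u v)"

text \<open>
  The record type of modules extends the one of rings, so it already carries a multiplication.
  Its field \<open>one\<close> plays no role here: algebras are neither unital nor associative.
\<close>

locale nonassoc_algebra = module F A + F?: field F
  for F (structure) and A (structure) +
  assumes mult_bilinear: "bilinear_map F A A A (\<lambda>x y. x \<otimes>\<^bsub>A\<^esub> y)"

locale g_alternative_algebra = nonassoc_algebra F A
  for F (structure) and A (structure) +
  assumes g_alt_left: "\<lbrakk>x \<in> carrier A; y \<in> carrier A; z \<in> carrier A\<rbrakk> \<Longrightarrow>
      x \<otimes>\<^bsub>A\<^esub> (y \<otimes>\<^bsub>A\<^esub> z)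
        = (x \<otimes>\<^bsub>A\<^esub> y) \<otimes>\<^bsub>A\<^esub> z \<oplus>\<^bsub>A\<^esub> (y \<otimes>\<^bsub>A\<^esub> x) \<otimes>\<^bsub>A\<^esub> z \<ominus>\<^bsub>A\<^esub> y \<otimes>\<^bsub>A\<^esub> (x \<otimes>\<^bsub>A\<^esub> z)"
    and g_alt_right: "\<lbrakk>x \<in> carrier A; y \<in> carrier A; z \<in> carrier A\<rbrakk> \<Longrightarrow>
      (x \<otimes>\<^bsub>A\<^esub> y) \<otimes>\<^bsub>A\<^esub> z
        = x \<otimes>\<^bsub>A\<^esub> (y \<otimes>\<^bsub>A\<^esub> z) \<oplus>\<^bsub>A\<^esub> x \<otimes>\<^bsub>A\<^esub> (z \<otimes>\<^bsub>A\<^esub> y) \<ominus>\<^bsub>A\<^esub> (x \<otimes>\<^bsub>A\<^esub> z) \<otimes>\<^bsub>A\<^esub> y"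


section \<open>Derived actions\<close>

text \<open>\<open>l b a\<close> stands for $ba$ and \<open>r a b\<close> for $ab$.\<close>

locale derived_action =
  B: g_alternative_algebra F B + A: g_alternative_algebra F A
  for F (structure) and B and A (structure) +
  fixes l :: "'b \<Rightarrow> 'a \<Rightarrow> 'a" and r :: "'a \<Rightarrow> 'b \<Rightarrow> 'a"
  assumes l_bilinear: "bilinear_map F B A A l"
    and r_bilinear: "bilinear_map F A B A r"
    and act1: "\<lbrakk>b \<in> carrier B; a\<^sub>1 \<in> carrier A; a\<^sub>2 \<in> carrier A\<rbrakk> \<Longrightarrow>
      l b (a\<^sub>1 \<otimes>\<^bsub>A\<^esub> a\<^sub>2) = l b a\<^sub>1 \<otimes>\<^bsub>A\<^esub> a\<^sub>2 \<oplus>\<^bsub>A\<^esub> r a\<^sub>1 b \<otimes>\<^bsub>A\<^esub> a\<^sub>2 \<ominus>\<^bsub>A\<^esub> a\<^sub>1 \<otimes>\<^bsub>A\<^esub> l b a\<^sub>2"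
    and act2: "\<lbrakk>b \<in> carrier B; a\<^sub>1 \<in> carrier A; a\<^sub>2 \<in> carrier A\<rbrakk> \<Longrightarrow>
      r (a\<^sub>1 \<otimes>\<^bsub>A\<^esub> a\<^sub>2) b = a\<^sub>1 \<otimes>\<^bsub>A\<^esub> r a\<^sub>2 b \<oplus>\<^bsub>A\<^esub> a\<^sub>1 \<otimes>\<^bsub>A\<^esub> l b a\<^sub>2 \<ominus>\<^bsub>A\<^esub> r a\<^sub>1 b \<otimes>\<^bsub>A\<^esub> a\<^sub>2"
    and act3: "\<lbrakk>b \<in> carrier B; a\<^sub>1 \<in> carrier A; a\<^sub>2 \<in> carrier A\<rbrakk> \<Longrightarrow>
      l b a\<^sub>1 \<otimes>\<^bsub>A\<^esub> a\<^sub>2 = l b (a\<^sub>1 \<otimes>\<^bsub>A\<^esub> a\<^sub>2) \<oplus>\<^bsub>A\<^esub> l b (a\<^sub>2 \<otimes>\<^bsub>A\<^esub> a\<^sub>1) \<ominus>\<^bsub>A\<^esub> l b a\<^sub>2 \<otimes>\<^bsub>A\<^esub> a\<^sub>1"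
    and act4: "\<lbrakk>b \<in> carrier B; a\<^sub>1 \<in> carrier A; a\<^sub>2 \<in> carrier A\<rbrakk> \<Longrightarrow>
      a\<^sub>1 \<otimes>\<^bsub>A\<^esub> r a\<^sub>2 b = r (a\<^sub>1 \<otimes>\<^bsub>A\<^esub> a\<^sub>2) b \<oplus>\<^bsub>A\<^esub> r (a\<^sub>2 \<otimes>\<^bsub>A\<^esub> a\<^sub>1) b \<ominus>\<^bsub>A\<^esub> a\<^sub>2 \<otimes>\<^bsub>A\<^esub> r a\<^sub>1 b"
    and act5: "\<lbrakk>b\<^sub>1 \<in> carrier B; b\<^sub>2 \<in> carrier B; a \<in> carrier A\<rbrakk> \<Longrightarrow>
      l (b\<^sub>1 \<otimes>\<^bsub>B\<^esub> b\<^sub>2) a = l b\<^sub>1 (l b\<^sub>2 a) \<oplus>\<^bsub>A\<^esub> l b\<^sub>1 (r a b\<^sub>2) \<ominus>\<^bsub>A\<^esub> r (l b\<^sub>1 a) b\<^sub>2"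
    and act6: "\<lbrakk>b\<^sub>1 \<in> carrier B; b\<^sub>2 \<in> carrier B; a \<in> carrier A\<rbrakk> \<Longrightarrow>
      r a (b\<^sub>1 \<otimes>\<^bsub>B\<^esub> b\<^sub>2) = r (r a b\<^sub>1) b\<^sub>2 \<oplus>\<^bsub>A\<^esub> r (l b\<^sub>1 a) b\<^sub>2 \<ominus>\<^bsub>A\<^esub> l b\<^sub>1 (r a b\<^sub>2)"
    and act7: "\<lbrakk>b\<^sub>1 \<in> carrier B; b\<^sub>2 \<in> carrier B; a \<in> carrier A\<rbrakk> \<Longrightarrow>
      r (r a b\<^sub>1) b\<^sub>2 = r a (b\<^sub>1 \<otimes>\<^bsub>B\<^esub> b\<^sub>2) \<oplus>\<^bsub>A\<^esub> r a (b\<^sub>2 \<otimes>\<^bsub>B\<^esub> b\<^sub>1) \<ominus>\<^bsub>A\<^esub> r (r a b\<^sub>2) b\<^sub>1"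
    and act8: "\<lbrakk>b\<^sub>1 \<in> carrier B; b\<^sub>2 \<in> carrier B; a \<in> carrier A\<rbrakk> \<Longrightarrow>
      l b\<^sub>1 (l b\<^sub>2 a) = l (b\<^sub>1 \<otimes>\<^bsub>B\<^esub> b\<^sub>2) a \<oplus>\<^bsub>A\<^esub> l (b\<^sub>2 \<otimes>\<^bsub>B\<^esub> b\<^sub>1) a \<ominus>\<^bsub>A\<^esub> l b\<^sub>2 (l b\<^sub>1 a)"


section \<open>Pairs of maps and the universal strict general actor\<close>

text \<open>
  The maps of a pair are restricted to \<open>carrier A\<close> (they are \<open>undefined\<close> outside it), so that two
  pairs are equal as soon as they give the same maps on $A$.
\<close>

type_synonym 'a map_pair = "('a \<Rightarrow> 'a) \<times> ('a \<Rightarrow> 'a)"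

abbreviation pair_left :: "'a map_pair \<Rightarrow> 'a \<Rightarrow> 'a" (infix \<open>\<triangleright>\<close> 80)
  where "f \<triangleright> a \<equiv> fst f a"

abbreviation pair_right :: "'a \<Rightarrow> 'a map_pair \<Rightarrow> 'a" (infix \<open>\<triangleleft>\<close> 80)
  where "a \<triangleleft> f \<equiv> snd f a"

definition pair_zero :: "('f, 'a, 'n) module_scheme \<Rightarrow> 'a map_pair"
  where "pair_zero A = (\<lambda>a\<in>carrier A. \<zero>\<^bsub>A\<^esub>, \<lambda>a\<in>carrier A. \<zero>\<^bsub>A\<^esub>)"

definition pair_add :: "('f, 'a, 'n) module_scheme \<Rightarrow> 'a map_pair \<Rightarrow> 'a map_pair \<Rightarrow> 'a map_pair"
  where "pair_add A f f' =
    (\<lambda>a\<in>carrier A. f \<triangleright> a \<oplus>\<^bsub>A\<^esub> f' \<triangleright> a, \<lambda>a\<in>carrier A. a \<triangleleft> f \<oplus>\<^bsub>A\<^esub> a \<triangleleft> f')"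

definition pair_neg :: "('f, 'a, 'n) module_scheme \<Rightarrow> 'a map_pair \<Rightarrow> 'a map_pair"
  where "pair_neg A f = (\<lambda>a\<in>carrier A. \<ominus>\<^bsub>A\<^esub> (f \<triangleright> a), \<lambda>a\<in>carrier A. \<ominus>\<^bsub>A\<^esub> (a \<triangleleft> f))"

definition pair_smult :: "('f, 'a, 'n) module_scheme \<Rightarrow> 'f \<Rightarrow> 'a map_pair \<Rightarrow> 'a map_pair"
  where "pair_smult A c f = (\<lambda>a\<in>carrier A. c \<odot>\<^bsub>A\<^esub> (f \<triangleright> a), \<lambda>a\<in>carrier A. c \<odot>\<^bsub>A\<^esub> (a \<triangleleft> f))"

definition pair_mult :: "('f, 'a, 'n) module_scheme \<Rightarrow> 'a map_pair \<Rightarrow> 'a map_pair \<Rightarrow> 'a map_pair"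
  where "pair_mult A f f' =
    (\<lambda>a\<in>carrier A. f \<triangleright> (f' \<triangleright> a) \<oplus>\<^bsub>A\<^esub> f \<triangleright> (a \<triangleleft> f') \<ominus>\<^bsub>A\<^esub> (f \<triangleright> a) \<triangleleft> f',
     \<lambda>a\<in>carrier A. (a \<triangleleft> f) \<triangleleft> f' \<oplus>\<^bsub>A\<^esub> (f \<triangleright> a) \<triangleleft> f' \<ominus>\<^bsub>A\<^esub> f \<triangleright> (a \<triangleleft> f'))"

text \<open>As above, the field \<open>one\<close> is irrelevant.\<close>

definition pair_structure ::
  "('f, 'a, 'n) module_scheme \<Rightarrow> 'a map_pair set \<Rightarrow> ('f, 'a map_pair) module"
  where "pair_structure A S = \<lparr>carrier = S, mult = pair_mult A, one = undefined,
    zero = pair_zero A, add = pair_add A, smult = pair_smult A\<rparr>"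

definition action_pair ::
  "('f, 'a, 'n) module_scheme \<Rightarrow> ('b \<Rightarrow> 'a \<Rightarrow> 'a) \<Rightarrow> ('a \<Rightarrow> 'b \<Rightarrow> 'a) \<Rightarrow> 'b \<Rightarrow> 'a map_pair"
  where "action_pair A l r b = (\<lambda>a\<in>carrier A. l b a, \<lambda>a\<in>carrier A. r a b)"

text \<open>
  The family of all g-alternative algebras acting on $A$ ranges over all types, which cannot be
  quantified over in a definition. Here the carriers are taken inside the type of pairs of maps
  $A \to A$. By lemma \<open>derived_action_in_acting_pairs\<close> below no pair is lost: an algebra
  of any type acting on $A$ gives only pairs that belong to this set.
\<close>

definition acting_pairs ::
  "('f, 'm) ring_scheme \<Rightarrow> ('f, 'a, 'n) module_scheme \<Rightarrow> 'a map_pair set"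
  where "acting_pairs F A = {action_pair A l r b | (B :: ('f, 'a map_pair) module) l r b.
    derived_action F B A l r \<and> b \<in> carrier B}"

inductive_set actor_carrier ::
  "('f, 'm) ring_scheme \<Rightarrow> ('f, 'a, 'n) module_scheme \<Rightarrow> 'a map_pair set"
  for F :: "('f, 'm) ring_scheme" and A :: "('f, 'a, 'n) module_scheme"
  where
    base: "f \<in> acting_pairs F A \<Longrightarrow> f \<in> actor_carrier F A"
  | add: "\<lbrakk>f \<in> actor_carrier F A; f' \<in> actor_carrier F A\<rbrakk> \<Longrightarrow> pair_add A f f' \<in> actor_carrier F A"
  | neg: "f \<in> actor_carrier F A \<Longrightarrow> pair_neg A f \<in> actor_carrier F A"
  | mult: "\<lbrakk>f \<in> actor_carrier F A; f' \<in> actor_carrier F A\<rbrakk> \<Longrightarrow> pair_mult A f f' \<in> actor_carrier F A"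

definition universal_strict_general_actor ::
  "('f, 'm) ring_scheme \<Rightarrow> ('f, 'a, 'n) module_scheme \<Rightarrow> ('f, 'a map_pair) module"  (\<open>\<BB>\<close>)
  where "\<BB> F A = pair_structure A (actor_carrier F A)"


section \<open>Independence of the type of the acting algebra\<close>

lemma bilinear_mapD:
  assumes "bilinear_map F U V W \<beta>"
  shows "\<lbrakk>u \<in> carrier U; v \<in> carrier V\<rbrakk> \<Longrightarrow> \<beta> u v \<in> carrier W"
    and "\<lbrakk>u \<in> carrier U; u' \<in> carrier U; v \<in> carrier V\<rbrakk> \<Longrightarrow>
      \<beta> (u \<oplus>\<^bsub>U\<^esub> u') v = \<beta> u v \<oplus>\<^bsub>W\<^esub> \<beta> u' v"
    and "\<lbrakk>u \<in> carrier U; v \<in> carrier V; v' \<in> carrier V\<rbrakk> \<Longrightarrow>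
      \<beta> u (v \<oplus>\<^bsub>V\<^esub> v') = \<beta> u v \<oplus>\<^bsub>W\<^esub> \<beta> u v'"
    and "\<lbrakk>c \<in> carrier F; u \<in> carrier U; v \<in> carrier V\<rbrakk> \<Longrightarrow>
      \<beta> (c \<odot>\<^bsub>U\<^esub> u) v = c \<odot>\<^bsub>W\<^esub> \<beta> u v"
    and "\<lbrakk>c \<in> carrier F; u \<in> carrier U; v \<in> carrier V\<rbrakk> \<Longrightarrow>
      \<beta> u (c \<odot>\<^bsub>V\<^esub> v) = c \<odot>\<^bsub>W\<^esub> \<beta> u v"
  using assms unfolding bilinear_map_def by blast+

lemmas (in derived_action) l_simps = bilinear_mapD[OF l_bilinear]
lemmas (in derived_action) r_simps = bilinear_mapD[OF r_bilinear]
lemmas (in derived_action) B_mult_simps = bilinear_mapD[OF B.mult_bilinear]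

lemma (in derived_action) action_pair_add:
  "\<lbrakk>b \<in> carrier B; b' \<in> carrier B\<rbrakk> \<Longrightarrow>
    pair_add A (action_pair A l r b) (action_pair A l r b') = action_pair A l r (b \<oplus>\<^bsub>B\<^esub> b')"
  by (auto simp: action_pair_def pair_add_def l_simps r_simps intro!: restrict_ext)

lemma (in derived_action) action_pair_mult:
  "\<lbrakk>b \<in> carrier B; b' \<in> carrier B\<rbrakk> \<Longrightarrow>
    pair_mult A (action_pair A l r b) (action_pair A l r b') = action_pair A l r (b \<otimes>\<^bsub>B\<^esub> b')"
  by (auto simp: action_pair_def pair_mult_def l_simps r_simps act5 act6 intro!: restrict_ext)

lemma (in derived_action) action_pair_smult:
  "\<lbrakk>c \<in> carrier F; b \<in> carrier B\<rbrakk> \<Longrightarrow>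
    pair_smult A c (action_pair A l r b) = action_pair A l r (c \<odot>\<^bsub>B\<^esub> b)"
  by (auto simp: action_pair_def pair_smult_def l_simps r_simps intro!: restrict_ext)

lemma (in derived_action) action_pair_zero: "pair_zero A = action_pair A l r \<zero>\<^bsub>B\<^esub>"
proof -
  have "l \<zero>\<^bsub>B\<^esub> a = \<zero>\<^bsub>A\<^esub>" if "a \<in> carrier A" for a
    using l_simps(4)[of "\<zero>\<^bsub>F\<^esub>" "\<zero>\<^bsub>B\<^esub>" a] l_simps(1)[of "\<zero>\<^bsub>B\<^esub>" a] that by simp
  moreover have "r a \<zero>\<^bsub>B\<^esub> = \<zero>\<^bsub>A\<^esub>" if "a \<in> carrier A" for a
    using r_simps(5)[of "\<zero>\<^bsub>F\<^esub>" a "\<zero>\<^bsub>B\<^esub>"] r_simps(1)[of a "\<zero>\<^bsub>B\<^esub>"] that by simp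
  ultimately show ?thesis
    by (auto simp: action_pair_def pair_zero_def intro!: restrict_ext)
qed

lemma (in derived_action) derived_action_image:
  defines "P \<equiv> pair_structure A (action_pair A l r ` carrier B)"
  shows "derived_action F P A fst (\<lambda>a f. snd f a)"
proof -
  let ?\<Phi> = "action_pair A l r"
  have carrier_P: "carrier P = ?\<Phi> ` carrier B"
    by (simp add: P_def pair_structure_def)
  have P_add: "?\<Phi> b \<oplus>\<^bsub>P\<^esub> ?\<Phi> b' = ?\<Phi> (b \<oplus>\<^bsub>B\<^esub> b')"
    if "b \<in> carrier B" "b' \<in> carrier B" for b b'
    using action_pair_add that by (simp add: P_def pair_structure_def)
  have P_mult: "?\<Phi> b \<otimes>\<^bsub>P\<^esub> ?\<Phi> b' = ?\<Phi> (b \<otimes>\<^bsub>B\<^esub> b')"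
    if "b \<in> carrier B" "b' \<in> carrier B" for b b'
    using action_pair_mult that by (simp add: P_def pair_structure_def)
  have P_smult: "c \<odot>\<^bsub>P\<^esub> ?\<Phi> b = ?\<Phi> (c \<odot>\<^bsub>B\<^esub> b)"
    if "c \<in> carrier F" "b \<in> carrier B" for b c
    using action_pair_smult that by (simp add: P_def pair_structure_def)
  have P_zero: "\<zero>\<^bsub>P\<^esub> = ?\<Phi> \<zero>\<^bsub>B\<^esub>"
    using action_pair_zero by (simp add: P_def pair_structure_def)
  note P_simps = carrier_P P_add P_mult P_smult P_zero B_mult_simps(1)
  have ag: "abelian_group P"
  proof (rule abelian_groupI)
    fix x assume "x \<in> carrier P"
    then obtain b where "b \<in> carrier B" "x = ?\<Phi> b" by (auto simp: carrier_P)
    then show "\<exists>y\<in>carrier P. y \<oplus>\<^bsub>P\<^esub> x = \<zero>\<^bsub>P\<^esub>"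
      by (auto simp: P_simps B.l_neg intro!: bexI[of _ "\<ominus>\<^bsub>B\<^esub> b"])
  qed (auto simp: P_simps B.a_ac)
  interpret P: abelian_group P by (rule ag)
  have P_neg: "\<ominus>\<^bsub>P\<^esub> ?\<Phi> b = ?\<Phi> (\<ominus>\<^bsub>B\<^esub> b)" if "b \<in> carrier B" for b
    by (rule P.minus_equality) (use that in \<open>auto simp: P_simps B.l_neg\<close>)
  have P_minus: "?\<Phi> b \<ominus>\<^bsub>P\<^esub> ?\<Phi> b' = ?\<Phi> (b \<ominus>\<^bsub>B\<^esub> b')"
    if "b \<in> carrier B" "b' \<in> carrier B" for b b'
    using that by (simp add: a_minus_def P_neg P_add)
  have "module F P"
    by (rule moduleI)
      (auto simp: P_simps ag B.R.cring_axioms B.smult_l_distr B.smult_r_distr B.smult_assoc1)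
  moreover have "bilinear_map F P P P (\<lambda>x y. x \<otimes>\<^bsub>P\<^esub> y)"
    by (auto simp: bilinear_map_def P_simps B_mult_simps)
  ultimately have g_alt_P: "g_alternative_algebra F P"
    by (auto intro!: g_alternative_algebra.intro nonassoc_algebra.intro
        nonassoc_algebra_axioms.intro g_alternative_algebra_axioms.intro
        simp: B.F.field_axioms P_simps P_minus B.g_alt_left[symmetric] B.g_alt_right[symmetric])
  have fst_\<Phi>: "fst (?\<Phi> b) a = l b a" and snd_\<Phi>: "snd (?\<Phi> b) a = r a b"
    if "a \<in> carrier A" for a b
    using that by (auto simp: action_pair_def)
  note act_simps = P_simps fst_\<Phi> snd_\<Phi> l_simps(1) r_simps(1) bilinear_mapD(1)[OF A.mult_bilinear]
  have "derived_action_axioms F P A fst (\<lambda>a f. snd f a)"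
    apply (rule derived_action_axioms.intro)
    unfolding bilinear_map_def
    subgoal by (auto simp: P_simps fst_\<Phi> l_simps)
    subgoal by (auto simp: P_simps snd_\<Phi> r_simps)
    subgoal by (clarsimp simp: act_simps) (rule act1)
    subgoal by (clarsimp simp: act_simps) (rule act2)
    subgoal by (clarsimp simp: act_simps) (rule act3)
    subgoal by (clarsimp simp: act_simps) (rule act4)
    subgoal by (clarsimp simp: act_simps) (rule act5)
    subgoal by (clarsimp simp: act_simps) (rule act6)
    subgoal by (clarsimp simp: act_simps) (rule act7)
    subgoal by (clarsimp simp: act_simps) (rule act8)
    done
  then show ?thesis
    by (intro derived_action.intro g_alt_P A.g_alternative_algebra_axioms)
qed

lemma derived_action_in_acting_pairs:
  fixes B :: "('f, 'b, 'k) module_scheme"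
  assumes "derived_action F B A l r" and "b \<in> carrier B"
  shows "action_pair A l r b \<in> acting_pairs F A"
proof -
  interpret derived_action F B A l r by (rule assms)
  let ?P = "pair_structure A (action_pair A l r ` carrier B)"
  have "action_pair A l r b \<in> carrier ?P"
    using assms by (simp add: pair_structure_def)
  moreover have "action_pair A fst (\<lambda>a f. snd f a) (action_pair A l r b) = action_pair A l r b"
    by (auto simp: action_pair_def)
  ultimately show ?thesis
    using derived_action_image unfolding acting_pairs_def mem_Collect_eq by metis
qed

end

theory Submission
  imports Defs
begin

text \<open>
  Write $L_f a = fa$ and $R_f a = af$. The equalities (1)--(11) say that a word of length three in
  these operators whose leftmost letter is some $L$ equals, up to the sign $(-1)^{\# R}$, the word
  $L_f L_g L_h$ with the same indices, that a word whose leftmost letter is some $R$ equals, up to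
  sign, $R_f R_g R_h$, and that both $L_f L_g L_h$ and $R_f R_g R_h$ are skew-symmetric in $f, g, h$.
  Expanding the products, $f(gh)$ becomes the pair with both maps $-L_f L_g L_h$, and $(fg)h$ the
  pair with both maps $R_f R_g R_h$. So both are skew-symmetric in $f, g, h$, and each of the two
  g-alternative identities reads $0 = 0$ after moving one term to the other side.
\<close>

section \<open>Pairs of linear maps\<close>

text \<open>Every element of the actor turns out to be such a pair. Linearity allows the outer map
  of a nested product to be distributed over the three terms of the inner product. The two
  \<open>extensional\<close> clauses make a pair determined by its values on
  \<open>carrier A\<close>, so equations between pairs can be checked pointwise.\<close>

definition linear_pair ::
  "('f, 'm) ring_scheme \<Rightarrow> ('f, 'a, 'n) module_scheme \<Rightarrow> 'a map_pair \<Rightarrow> bool"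
  where "linear_pair F A f \<longleftrightarrow>
    fst f \<in> extensional (carrier A) \<and> snd f \<in> extensional (carrier A) \<and>
    (\<forall>a\<in>carrier A. f \<triangleright> a \<in> carrier A \<and> a \<triangleleft> f \<in> carrier A) \<and>
    (\<forall>a\<in>carrier A. \<forall>a'\<in>carrier A.
      f \<triangleright> (a \<oplus>\<^bsub>A\<^esub> a') = f \<triangleright> a \<oplus>\<^bsub>A\<^esub> f \<triangleright> a' \<and> (a \<oplus>\<^bsub>A\<^esub> a') \<triangleleft> f = a \<triangleleft> f \<oplus>\<^bsub>A\<^esub> a' \<triangleleft> f) \<and>
    (\<forall>c\<in>carrier F. \<forall>a\<in>carrier A.
      f \<triangleright> (c \<odot>\<^bsub>A\<^esub> a) = c \<odot>\<^bsub>A\<^esub> (f \<triangleright> a) \<and> (c \<odot>\<^bsub>A\<^esub> a) \<triangleleft> f = c \<odot>\<^bsub>A\<^esub> (a \<triangleleft> f))"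

lemma linear_pairD:
  assumes "linear_pair F A f"
  shows "a \<in> carrier A \<Longrightarrow> f \<triangleright> a \<in> carrier A"
    and "a \<in> carrier A \<Longrightarrow> a \<triangleleft> f \<in> carrier A"
    and "\<lbrakk>a \<in> carrier A; a' \<in> carrier A\<rbrakk> \<Longrightarrow> f \<triangleright> (a \<oplus>\<^bsub>A\<^esub> a') = f \<triangleright> a \<oplus>\<^bsub>A\<^esub> f \<triangleright> a'"
    and "\<lbrakk>a \<in> carrier A; a' \<in> carrier A\<rbrakk> \<Longrightarrow> (a \<oplus>\<^bsub>A\<^esub> a') \<triangleleft> f = a \<triangleleft> f \<oplus>\<^bsub>A\<^esub> a' \<triangleleft> f"
    and "\<lbrakk>c \<in> carrier F; a \<in> carrier A\<rbrakk> \<Longrightarrow> f \<triangleright> (c \<odot>\<^bsub>A\<^esub> a) = c \<odot>\<^bsub>A\<^esub> (f \<triangleright> a)"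
    and "\<lbrakk>c \<in> carrier F; a \<in> carrier A\<rbrakk> \<Longrightarrow> (c \<odot>\<^bsub>A\<^esub> a) \<triangleleft> f = c \<odot>\<^bsub>A\<^esub> (a \<triangleleft> f)"
  using assms unfolding linear_pair_def by blast+

lemma linear_pair_eqI:
  assumes "linear_pair F A f" and "linear_pair F A g"
    and "\<And>a. a \<in> carrier A \<Longrightarrow> f \<triangleright> a = g \<triangleright> a"
    and "\<And>a. a \<in> carrier A \<Longrightarrow> a \<triangleleft> f = a \<triangleleft> g"
  shows "f = g"
  by (rule prod_eqI; rule extensionalityI[where A = "carrier A"])
    (use assms in \<open>auto simp: linear_pair_def\<close>)

lemma pair_apply:
  assumes "a \<in> carrier A"
  shows "pair_add A f g \<triangleright> a = f \<triangleright> a \<oplus>\<^bsub>A\<^esub> g \<triangleright> a"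
    and "a \<triangleleft> pair_add A f g = a \<triangleleft> f \<oplus>\<^bsub>A\<^esub> a \<triangleleft> g"
    and "pair_neg A f \<triangleright> a = \<ominus>\<^bsub>A\<^esub> (f \<triangleright> a)"
    and "a \<triangleleft> pair_neg A f = \<ominus>\<^bsub>A\<^esub> (a \<triangleleft> f)"
    and "pair_smult A c f \<triangleright> a = c \<odot>\<^bsub>A\<^esub> (f \<triangleright> a)"
    and "a \<triangleleft> pair_smult A c f = c \<odot>\<^bsub>A\<^esub> (a \<triangleleft> f)"
    and "pair_mult A f g \<triangleright> a = f \<triangleright> (g \<triangleright> a) \<oplus>\<^bsub>A\<^esub> f \<triangleright> (a \<triangleleft> g) \<ominus>\<^bsub>A\<^esub> (f \<triangleright> a) \<triangleleft> g"
    and "a \<triangleleft> pair_mult A f g = (a \<triangleleft> f) \<triangleleft> g \<oplus>\<^bsub>A\<^esub> (f \<triangleright> a) \<triangleleft> g \<ominus>\<^bsub>A\<^esub> f \<triangleright> (a \<triangleleft> g)"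
    and "pair_zero A \<triangleright> a = \<zero>\<^bsub>A\<^esub>"
    and "a \<triangleleft> pair_zero A = \<zero>\<^bsub>A\<^esub>"
  using assms
  by (simp_all add: pair_add_def pair_neg_def pair_smult_def pair_mult_def pair_zero_def)

lemma pair_extensional:
  "fst (pair_add A f g) \<in> extensional (carrier A)" "snd (pair_add A f g) \<in> extensional (carrier A)"
  "fst (pair_neg A f) \<in> extensional (carrier A)" "snd (pair_neg A f) \<in> extensional (carrier A)"
  "fst (pair_smult A c f) \<in> extensional (carrier A)"
  "snd (pair_smult A c f) \<in> extensional (carrier A)"
  "fst (pair_mult A f g) \<in> extensional (carrier A)" "snd (pair_mult A f g) \<in> extensional (carrier A)"
  "fst (pair_zero A) \<in> extensional (carrier A)" "snd (pair_zero A) \<in> extensional (carrier A)"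
  by (simp_all add: pair_add_def pair_neg_def pair_smult_def pair_mult_def pair_zero_def)

section \<open>Operations on linear pairs over a module\<close>

context module
begin

text \<open>Negation in a module is scaling by $-1$, so homogeneity of the maps is enough.\<close>

lemma linear_pair_a_inv:
  assumes "linear_pair R M f" and "a \<in> carrier M"
  shows "f \<triangleright> (\<ominus>\<^bsub>M\<^esub> a) = \<ominus>\<^bsub>M\<^esub> (f \<triangleright> a)" and "(\<ominus>\<^bsub>M\<^esub> a) \<triangleleft> f = \<ominus>\<^bsub>M\<^esub> (a \<triangleleft> f)"
proof -
  note lin = linear_pairD[OF assms(1)]
  have neg: "\<ominus>\<^bsub>M\<^esub> x = (\<ominus>\<^bsub>R\<^esub> \<one>\<^bsub>R\<^esub>) \<odot>\<^bsub>M\<^esub> x" if "x \<in> carrier M" for x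
    using that by (simp add: smult_l_minus)
  show "f \<triangleright> (\<ominus>\<^bsub>M\<^esub> a) = \<ominus>\<^bsub>M\<^esub> (f \<triangleright> a)" "(\<ominus>\<^bsub>M\<^esub> a) \<triangleleft> f = \<ominus>\<^bsub>M\<^esub> (a \<triangleleft> f)"
    using assms(2) by (simp_all only: neg lin R.a_inv_closed R.one_closed)
qed

text \<open>The conclusion \<open>f = g\<close> mentions neither the field nor the module, so both
  are fixed here instead of being left to unification.\<close>

lemmas pair_eqI = linear_pair_eqI[where F = R and A = M]

lemmas linear_pair_simps = linear_pairD[where F = R and A = M] linear_pair_a_inv

lemmas abelian_simps = a_minus_def M.a_ac M.minus_add M.r_neg M.l_neg M.r_neg1 M.r_neg2

lemma linear_pair_zero: "linear_pair R M (pair_zero M)"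
  by (simp add: linear_pair_def pair_apply pair_extensional)

lemma linear_pair_add:
  "\<lbrakk>linear_pair R M f; linear_pair R M g\<rbrakk> \<Longrightarrow> linear_pair R M (pair_add M f g)"
  \<comment> \<open>The definition is instantiated so that it opens only in the goal; the premises
    on \<open>f\<close> and \<open>g\<close> stay folded and serve as side conditions of
    \<open>linear_pair_simps\<close>.\<close>
  unfolding linear_pair_def[of _ _ "pair_add M f g"]
  by (simp add: pair_apply pair_extensional linear_pair_simps smult_r_distr abelian_simps)

lemma linear_pair_neg: "linear_pair R M f \<Longrightarrow> linear_pair R M (pair_neg M f)"
  unfolding linear_pair_def[of _ _ "pair_neg M f"]
  by (simp add: pair_apply pair_extensional linear_pair_simps smult_r_minus abelian_simps)

lemma linear_pair_smult:
  "\<lbrakk>c \<in> carrier R; linear_pair R M f\<rbrakk> \<Longrightarrow> linear_pair R M (pair_smult M c f)"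
  unfolding linear_pair_def[of _ _ "pair_smult M c f"]
  \<comment> \<open>Homogeneity of a scaled map rests on commutativity of the scalars: the flipped
    \<open>smult_assoc1\<close> merges two nested scalars into one product, which
    \<open>R.m_comm\<close> reorders.\<close>
  by (simp add: pair_apply pair_extensional linear_pair_simps smult_r_distr R.m_comm
      flip: smult_assoc1)

lemma linear_pair_mult:
  "\<lbrakk>linear_pair R M f; linear_pair R M g\<rbrakk> \<Longrightarrow> linear_pair R M (pair_mult M f g)"
  unfolding linear_pair_def[of _ _ "pair_mult M f g"]
  by (simp add: pair_apply pair_extensional linear_pair_simps smult_r_distr smult_r_minus
      abelian_simps)

lemmas linear_pair_intros =
  linear_pair_zero linear_pair_add linear_pair_neg linear_pair_smult linear_pair_mult

lemmas pair_eq_simps =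
  pair_apply linear_pair_simps smult_r_distr smult_l_distr smult_r_minus smult_assoc1 abelian_simps

lemma pair_smult_add:
  "\<lbrakk>c \<in> carrier R; linear_pair R M f; linear_pair R M g\<rbrakk> \<Longrightarrow>
    pair_smult M c (pair_add M f g) = pair_add M (pair_smult M c f) (pair_smult M c g)"
  by (rule pair_eqI; simp add: linear_pair_intros pair_eq_simps)

lemma pair_smult_neg:
  "\<lbrakk>c \<in> carrier R; linear_pair R M f\<rbrakk> \<Longrightarrow> pair_smult M c (pair_neg M f) = pair_neg M (pair_smult M c f)"
  by (rule pair_eqI; simp add: linear_pair_intros pair_eq_simps)

text \<open>Each of the three terms in either map of \<open>pair_mult M f g\<close> applies
  \<open>f\<close> exactly once and \<open>g\<close> exactly once, so a scalar on either factor
  passes through linear maps to the outside. The same count gives additivity in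
  \<open>pair_mult_add\<close>.\<close>

lemma pair_smult_mult:
  assumes "c \<in> carrier R" "linear_pair R M f" "linear_pair R M g"
  shows "pair_mult M (pair_smult M c f) g = pair_smult M c (pair_mult M f g)"
    and "pair_mult M f (pair_smult M c g) = pair_smult M c (pair_mult M f g)"
  by (rule pair_eqI; simp add: assms linear_pair_intros pair_eq_simps)+

lemma pair_mult_add:
  assumes "linear_pair R M f" "linear_pair R M g" "linear_pair R M h"
  shows "pair_mult M (pair_add M f g) h = pair_add M (pair_mult M f h) (pair_mult M g h)"
    and "pair_mult M f (pair_add M g h) = pair_add M (pair_mult M f g) (pair_mult M f h)"
  by (rule pair_eqI; simp add: assms linear_pair_intros pair_eq_simps)+

lemma pair_add_neg: "linear_pair R M f \<Longrightarrow> pair_add M (pair_neg M f) f = pair_zero M"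
  by (rule pair_eqI; simp add: linear_pair_intros pair_eq_simps)

text \<open>The equational axioms are inherited pointwise from \<open>M\<close>; what a set of
  linear pairs has to supply is closure under the operations.\<close>

lemma module_pair_structure:
  assumes linear: "\<And>f. f \<in> S \<Longrightarrow> linear_pair R M f"
    and zero: "pair_zero M \<in> S"
    and add: "\<And>f g. \<lbrakk>f \<in> S; g \<in> S\<rbrakk> \<Longrightarrow> pair_add M f g \<in> S"
    and neg: "\<And>f. f \<in> S \<Longrightarrow> pair_neg M f \<in> S"
    and smult: "\<And>c f. \<lbrakk>c \<in> carrier R; f \<in> S\<rbrakk> \<Longrightarrow> pair_smult M c f \<in> S"
  shows "module R (pair_structure M S)"
proof -
  have "abelian_group (pair_structure M S)"
  proof (rule abelian_groupI)
    fix f assume "f \<in> carrier (pair_structure M S)"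
    then show "\<exists>g\<in>carrier (pair_structure M S).
        g \<oplus>\<^bsub>pair_structure M S\<^esub> f = \<zero>\<^bsub>pair_structure M S\<^esub>"
      by (auto simp: pair_structure_def pair_add_neg linear neg intro!: bexI[of _ "pair_neg M f"])
  qed (simp_all add: pair_structure_def zero add,
      (rule pair_eqI; simp add: linear linear_pair_intros pair_eq_simps)+)
  then show ?thesis
    by (rule moduleI[OF R.cring_axioms], simp_all add: pair_structure_def smult)
      (rule pair_eqI; simp add: linear linear_pair_intros pair_eq_simps)+
qed

end


section \<open>The universal strict general actor is an algebra\<close>

lemma (in derived_action) linear_pair_action_pair:
  "b \<in> carrier B \<Longrightarrow> linear_pair F A (action_pair A l r b)"
  by (simp add: linear_pair_def action_pair_def l_simps r_simps)

text \<open>Generators are linear because a derived action is bilinear, and each of the three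
  generating operations preserves linearity.\<close>

lemma actor_carrier_linear:
  assumes "module F A" and "f \<in> actor_carrier F A"
  shows "linear_pair F A f"
proof -
  interpret module F A by fact
  show ?thesis
    using assms(2)
  proof induction
    case (base f)
    then show ?case
      unfolding acting_pairs_def by (auto intro: derived_action.linear_pair_action_pair)
  qed (auto intro: linear_pair_intros)
qed

text \<open>If \<open>f\<close> comes from an element \<open>b\<close> of an acting algebra, its
  multiple by \<open>c\<close> comes from the multiple of \<open>b\<close> by \<open>c\<close> in
  the same algebra.\<close>

lemma acting_pairs_smult:
  fixes F :: "('f, 'm) ring_scheme" and A :: "('f, 'a, 'n) module_scheme"
  assumes "c \<in> carrier F" and "f \<in> acting_pairs F A"
  shows "pair_smult A c f \<in> acting_pairs F A"
proof -
  obtain B :: "('f, 'a map_pair) module" and l r b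
    where act: "derived_action F B A l r" and b: "b \<in> carrier B" and f: "f = action_pair A l r b"
    using assms(2) unfolding acting_pairs_def by blast
  interpret derived_action F B A l r by fact
  show ?thesis
    using derived_action_in_acting_pairs[OF act] assms(1) b by (simp add: f action_pair_smult)
qed

text \<open>Scaling is not among the generating operations, so closure under it is proved by
  induction: the scalar is pushed through sums, negatives and products down to the generators, where
  \<open>acting_pairs_smult\<close> absorbs it.\<close>

lemma actor_carrier_smult:
  assumes "module F A" and "c \<in> carrier F" and "f \<in> actor_carrier F A"
  shows "pair_smult A c f \<in> actor_carrier F A"
proof -
  interpret module F A by fact
  note linear = actor_carrier_linear[OF assms(1)]
  from assms(3) show ?thesis
  proof induction
    \<comment> \<open>The left factor alone takes the scalar; the induction hypothesis for
      \<open>f\<close> keeps it in the actor.\<close>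
    case (mult f g)
    then show ?case
      using assms(2) actor_carrier.mult[of "pair_smult A c f" F A g]
      by (simp add: pair_smult_mult linear)
  qed (use assms(2) in \<open>auto simp: pair_smult_add pair_smult_neg linear
      intro: actor_carrier.intros acting_pairs_smult\<close>)
qed

text \<open>When the action is the multiplication of \<open>A\<close> itself, the eight axioms
  become instances of the two g-alternative identities: \<open>act1\<close>, \<open>act4\<close>,
  \<open>act6\<close>, \<open>act8\<close> of the left one, the other four of the right one.\<close>

lemma (in g_alternative_algebra) derived_action_self:
  "derived_action F A A (\<lambda>x y. x \<otimes>\<^bsub>A\<^esub> y) (\<lambda>x y. x \<otimes>\<^bsub>A\<^esub> y)"
  by (intro derived_action.intro derived_action_axioms.intro g_alternative_algebra_axioms)
    (rule mult_bilinear | rule g_alt_left; assumption | rule g_alt_right; assumption)+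

text \<open>The generating rules do not provide a zero outright. Since \<open>A\<close> acts on
  itself, there is at least one acting algebra, and its zero element gives the zero pair.\<close>

lemma (in g_alternative_algebra) pair_zero_in_actor_carrier: "pair_zero A \<in> actor_carrier F A"
proof -
  interpret self: derived_action F A A "\<lambda>x y. x \<otimes>\<^bsub>A\<^esub> y" "\<lambda>x y. x \<otimes>\<^bsub>A\<^esub> y"
    by (rule derived_action_self)
  show ?thesis
    using derived_action_in_acting_pairs[OF derived_action_self]
    by (simp add: self.action_pair_zero actor_carrier.base)
qed

text \<open>This settles the linear structure and the bilinear product of the actor, leaving only
  the two g-alternative identities.\<close>

lemma (in g_alternative_algebra) nonassoc_algebra_actor: "nonassoc_algebra F (\<BB> F A)"
proof -
  note linear = actor_carrier_linear[OF module_axioms]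
  note smult = actor_carrier_smult[OF module_axioms]
  have "module F (\<BB> F A)"
    unfolding universal_strict_general_actor_def
    by (rule module_pair_structure)
      (auto intro: linear smult pair_zero_in_actor_carrier actor_carrier.intros)
  moreover have "bilinear_map F (\<BB> F A) (\<BB> F A) (\<BB> F A) (\<lambda>f g. f \<otimes>\<^bsub>\<BB> F A\<^esub> g)"
    by (auto simp: bilinear_map_def universal_strict_general_actor_def pair_structure_def
        pair_mult_add pair_smult_mult linear intro: actor_carrier.mult)
  ultimately show ?thesis
    by (intro nonassoc_algebra.intro nonassoc_algebra_axioms.intro F.field_axioms)
qed


section \<open>Skew-symmetric triple products\<close>

text \<open>The equalities keep the order of the theorem. \<open>id1\<close>, \<open>id6\<close>,
  \<open>id7\<close> normalise words with leftmost letter $L$, and \<open>id3\<close>,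
  \<open>id8\<close>, \<open>id9\<close> those with leftmost letter $R$. Skew-symmetry comes from
  \<open>id4\<close>, \<open>id11\<close> for $L_f L_g L_h$ and from \<open>id5\<close>,
  \<open>id10\<close> for $R_f R_g R_h$.\<close>

locale actor_identities = g_alternative_algebra F A
  for F (structure) and A (structure) +
  assumes id1: "\<And>b\<^sub>1 b\<^sub>2 b\<^sub>3 a. \<lbrakk>b\<^sub>1 \<in> carrier (\<BB> F A); b\<^sub>2 \<in> carrier (\<BB> F A); b\<^sub>3 \<in> carrier (\<BB> F A); a \<in> carrier A\<rbrakk> \<Longrightarrow>
      b\<^sub>1 \<triangleright> (b\<^sub>2 \<triangleright> (b\<^sub>3 \<triangleright> a)) \<oplus>\<^bsub>A\<^esub> b\<^sub>1 \<triangleright> (b\<^sub>2 \<triangleright> (a \<triangleleft> b\<^sub>3)) = \<zero>\<^bsub>A\<^esub>"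
    and id2: "\<And>b\<^sub>1 b\<^sub>2 b\<^sub>3 a. \<lbrakk>b\<^sub>1 \<in> carrier (\<BB> F A); b\<^sub>2 \<in> carrier (\<BB> F A); b\<^sub>3 \<in> carrier (\<BB> F A); a \<in> carrier A\<rbrakk> \<Longrightarrow>
      b\<^sub>1 \<triangleright> ((a \<triangleleft> b\<^sub>2) \<triangleleft> b\<^sub>3) \<oplus>\<^bsub>A\<^esub> b\<^sub>1 \<triangleright> ((b\<^sub>2 \<triangleright> a) \<triangleleft> b\<^sub>3) = \<zero>\<^bsub>A\<^esub>"
    and id3: "\<And>b\<^sub>1 b\<^sub>2 b\<^sub>3 a. \<lbrakk>b\<^sub>1 \<in> carrier (\<BB> F A); b\<^sub>2 \<in> carrier (\<BB> F A); b\<^sub>3 \<in> carrier (\<BB> F A); a \<in> carrier A\<rbrakk> \<Longrightarrow>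
      ((b\<^sub>1 \<triangleright> a) \<triangleleft> b\<^sub>2) \<triangleleft> b\<^sub>3 \<oplus>\<^bsub>A\<^esub> (b\<^sub>2 \<triangleright> (b\<^sub>1 \<triangleright> a)) \<triangleleft> b\<^sub>3 = \<zero>\<^bsub>A\<^esub>"
    and id4: "\<And>b\<^sub>1 b\<^sub>2 b\<^sub>3 a. \<lbrakk>b\<^sub>1 \<in> carrier (\<BB> F A); b\<^sub>2 \<in> carrier (\<BB> F A); b\<^sub>3 \<in> carrier (\<BB> F A); a \<in> carrier A\<rbrakk> \<Longrightarrow>
      b\<^sub>1 \<triangleright> (b\<^sub>2 \<triangleright> (a \<triangleleft> b\<^sub>3)) \<oplus>\<^bsub>A\<^esub> b\<^sub>2 \<triangleright> (b\<^sub>1 \<triangleright> (a \<triangleleft> b\<^sub>3)) = \<zero>\<^bsub>A\<^esub>"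
    and id5: "\<And>b\<^sub>1 b\<^sub>2 b\<^sub>3 a. \<lbrakk>b\<^sub>1 \<in> carrier (\<BB> F A); b\<^sub>2 \<in> carrier (\<BB> F A); b\<^sub>3 \<in> carrier (\<BB> F A); a \<in> carrier A\<rbrakk> \<Longrightarrow>
      ((b\<^sub>1 \<triangleright> a) \<triangleleft> b\<^sub>2) \<triangleleft> b\<^sub>3 \<oplus>\<^bsub>A\<^esub> ((b\<^sub>2 \<triangleright> a) \<triangleleft> b\<^sub>1) \<triangleleft> b\<^sub>3 = \<zero>\<^bsub>A\<^esub>"
    and id6: "\<And>b\<^sub>1 b\<^sub>2 b\<^sub>3 a. \<lbrakk>b\<^sub>1 \<in> carrier (\<BB> F A); b\<^sub>2 \<in> carrier (\<BB> F A); b\<^sub>3 \<in> carrier (\<BB> F A); a \<in> carrier A\<rbrakk> \<Longrightarrow>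
      b\<^sub>1 \<triangleright> (b\<^sub>2 \<triangleright> (b\<^sub>3 \<triangleright> a)) \<oplus>\<^bsub>A\<^esub> b\<^sub>1 \<triangleright> ((b\<^sub>3 \<triangleright> a) \<triangleleft> b\<^sub>2) = \<zero>\<^bsub>A\<^esub>"
    and id7: "\<And>b\<^sub>1 b\<^sub>2 b\<^sub>3 a. \<lbrakk>b\<^sub>1 \<in> carrier (\<BB> F A); b\<^sub>2 \<in> carrier (\<BB> F A); b\<^sub>3 \<in> carrier (\<BB> F A); a \<in> carrier A\<rbrakk> \<Longrightarrow>
      b\<^sub>1 \<triangleright> (b\<^sub>2 \<triangleright> (a \<triangleleft> b\<^sub>3)) \<oplus>\<^bsub>A\<^esub> b\<^sub>1 \<triangleright> ((a \<triangleleft> b\<^sub>3) \<triangleleft> b\<^sub>2) = \<zero>\<^bsub>A\<^esub>"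
    and id8: "\<And>b\<^sub>1 b\<^sub>2 b\<^sub>3 a. \<lbrakk>b\<^sub>1 \<in> carrier (\<BB> F A); b\<^sub>2 \<in> carrier (\<BB> F A); b\<^sub>3 \<in> carrier (\<BB> F A); a \<in> carrier A\<rbrakk> \<Longrightarrow>
      (b\<^sub>1 \<triangleright> (b\<^sub>2 \<triangleright> a)) \<triangleleft> b\<^sub>3 \<oplus>\<^bsub>A\<^esub> (b\<^sub>1 \<triangleright> (a \<triangleleft> b\<^sub>2)) \<triangleleft> b\<^sub>3 = \<zero>\<^bsub>A\<^esub>"
    and id9: "\<And>b\<^sub>1 b\<^sub>2 b\<^sub>3 a. \<lbrakk>b\<^sub>1 \<in> carrier (\<BB> F A); b\<^sub>2 \<in> carrier (\<BB> F A); b\<^sub>3 \<in> carrier (\<BB> F A); a \<in> carrier A\<rbrakk> \<Longrightarrow>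
      ((a \<triangleleft> b\<^sub>1) \<triangleleft> b\<^sub>2) \<triangleleft> b\<^sub>3 \<oplus>\<^bsub>A\<^esub> (b\<^sub>2 \<triangleright> (a \<triangleleft> b\<^sub>1)) \<triangleleft> b\<^sub>3 = \<zero>\<^bsub>A\<^esub>"
    and id10: "\<And>b\<^sub>1 b\<^sub>2 b\<^sub>3 a. \<lbrakk>b\<^sub>1 \<in> carrier (\<BB> F A); b\<^sub>2 \<in> carrier (\<BB> F A); b\<^sub>3 \<in> carrier (\<BB> F A); a \<in> carrier A\<rbrakk> \<Longrightarrow>
      ((a \<triangleleft> b\<^sub>3) \<triangleleft> b\<^sub>1) \<triangleleft> b\<^sub>2 \<oplus>\<^bsub>A\<^esub> ((a \<triangleleft> b\<^sub>3) \<triangleleft> b\<^sub>2) \<triangleleft> b\<^sub>1 = \<zero>\<^bsub>A\<^esub>"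
    and id11: "\<And>b\<^sub>1 b\<^sub>2 b\<^sub>3 a. \<lbrakk>b\<^sub>1 \<in> carrier (\<BB> F A); b\<^sub>2 \<in> carrier (\<BB> F A); b\<^sub>3 \<in> carrier (\<BB> F A); a \<in> carrier A\<rbrakk> \<Longrightarrow>
      b\<^sub>3 \<triangleright> (b\<^sub>2 \<triangleright> (a \<triangleleft> b\<^sub>1)) \<oplus>\<^bsub>A\<^esub> b\<^sub>3 \<triangleright> (b\<^sub>1 \<triangleright> (a \<triangleleft> b\<^sub>2)) = \<zero>\<^bsub>A\<^esub>"
begin

section \<open>Normal forms of words of length three\<close>

lemma actor_closed:
  assumes "f \<in> carrier (\<BB> F A)" and "a \<in> carrier A"
  shows "f \<triangleright> a \<in> carrier A" and "a \<triangleleft> f \<in> carrier A"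
  using linear_pairD(1,2)[OF actor_carrier_linear[OF module_axioms]] assms
  by (simp_all add: universal_strict_general_actor_def pair_structure_def)

text \<open>\<open>id1\<close> changes the innermost letter after $L_f L_g$, while
  \<open>id6\<close> and \<open>id7\<close> change the middle one; each change costs a sign. For
  $L_f R_g R_h$ two changes are chained, so the signs cancel. The equations are oriented as rewrite
  rules towards $L_f L_g L_h$.\<close>

lemma word_L:
  assumes "f \<in> carrier (\<BB> F A)" "g \<in> carrier (\<BB> F A)" "h \<in> carrier (\<BB> F A)" "a \<in> carrier A"
  shows "f \<triangleright> (g \<triangleright> (a \<triangleleft> h)) = \<ominus>\<^bsub>A\<^esub> (f \<triangleright> (g \<triangleright> (h \<triangleright> a)))"
    and "f \<triangleright> ((h \<triangleright> a) \<triangleleft> g) = \<ominus>\<^bsub>A\<^esub> (f \<triangleright> (g \<triangleright> (h \<triangleright> a)))"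
    and "f \<triangleright> ((a \<triangleleft> h) \<triangleleft> g) = f \<triangleright> (g \<triangleright> (h \<triangleright> a))"
proof -
  note closed = assms actor_closed
  show LLR: "f \<triangleright> (g \<triangleright> (a \<triangleleft> h)) = \<ominus>\<^bsub>A\<^esub> (f \<triangleright> (g \<triangleright> (h \<triangleright> a)))"
    using id1[OF assms] by (intro M.minus_equality[symmetric]) (simp_all add: closed M.a_ac)
  show "f \<triangleright> ((h \<triangleright> a) \<triangleleft> g) = \<ominus>\<^bsub>A\<^esub> (f \<triangleright> (g \<triangleright> (h \<triangleright> a)))"
    using id6[OF assms] by (intro M.minus_equality[symmetric]) (simp_all add: closed M.a_ac)
  have "f \<triangleright> ((a \<triangleleft> h) \<triangleleft> g) = \<ominus>\<^bsub>A\<^esub> (f \<triangleright> (g \<triangleright> (a \<triangleleft> h)))"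
    using id7[OF assms] by (intro M.minus_equality[symmetric]) (simp_all add: closed M.a_ac)
  then show "f \<triangleright> ((a \<triangleleft> h) \<triangleleft> g) = f \<triangleright> (g \<triangleright> (h \<triangleright> a))"
    by (simp add: LLR closed)
qed

text \<open>The target is $R_f R_g R_h$, which is
  \<open>((a \<triangleleft> h) \<triangleleft> g) \<triangleleft> f\<close>. One sign change each
  leads from it to $R_f L_g R_h$ by \<open>id9\<close>, on to $R_f L_g L_h$ by \<open>id8\<close>,
  and on to $R_f R_g L_h$ by \<open>id3\<close>.\<close>

lemma word_R:
  assumes "f \<in> carrier (\<BB> F A)" "g \<in> carrier (\<BB> F A)" "h \<in> carrier (\<BB> F A)" "a \<in> carrier A"
  shows "(g \<triangleright> (a \<triangleleft> h)) \<triangleleft> f = \<ominus>\<^bsub>A\<^esub> (((a \<triangleleft> h) \<triangleleft> g) \<triangleleft> f)"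
    and "(g \<triangleright> (h \<triangleright> a)) \<triangleleft> f = ((a \<triangleleft> h) \<triangleleft> g) \<triangleleft> f"
    and "((h \<triangleright> a) \<triangleleft> g) \<triangleleft> f = \<ominus>\<^bsub>A\<^esub> (((a \<triangleleft> h) \<triangleleft> g) \<triangleleft> f)"
proof -
  note closed = assms actor_closed
  show RLR: "(g \<triangleright> (a \<triangleleft> h)) \<triangleleft> f = \<ominus>\<^bsub>A\<^esub> (((a \<triangleleft> h) \<triangleleft> g) \<triangleleft> f)"
    using id9[OF assms(3,2,1,4)]
    by (intro M.minus_equality[symmetric]) (simp_all add: closed M.a_ac)
  have "(g \<triangleright> (h \<triangleright> a)) \<triangleleft> f = \<ominus>\<^bsub>A\<^esub> ((g \<triangleright> (a \<triangleleft> h)) \<triangleleft> f)"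
    using id8[OF assms(2,3,1,4)]
    by (intro M.minus_equality[symmetric]) (simp_all add: closed M.a_ac)
  then show RLL: "(g \<triangleright> (h \<triangleright> a)) \<triangleleft> f = ((a \<triangleleft> h) \<triangleleft> g) \<triangleleft> f"
    by (simp add: RLR closed)
  have "((h \<triangleright> a) \<triangleleft> g) \<triangleleft> f = \<ominus>\<^bsub>A\<^esub> ((g \<triangleright> (h \<triangleright> a)) \<triangleleft> f)"
    using id3[OF assms(3,2,1,4)]
    by (intro M.minus_equality[symmetric]) (simp_all add: closed M.a_ac)
  then show "((h \<triangleright> a) \<triangleleft> g) \<triangleleft> f = \<ominus>\<^bsub>A\<^esub> (((a \<triangleleft> h) \<triangleleft> g) \<triangleleft> f)"
    by (simp add: RLL)
qed

text \<open>\<open>id4\<close> and \<open>id11\<close> are exactly these two transpositions, but for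
  words ending in an innermost $R$; \<open>word_L\<close> turns that letter into $L$ with the same
  sign in both summands. The two adjacent transpositions generate all permutations of the
  indices.\<close>

lemma LLL_skew:
  assumes "f \<in> carrier (\<BB> F A)" "g \<in> carrier (\<BB> F A)" "h \<in> carrier (\<BB> F A)" "a \<in> carrier A"
  shows "g \<triangleright> (f \<triangleright> (h \<triangleright> a)) = \<ominus>\<^bsub>A\<^esub> (f \<triangleright> (g \<triangleright> (h \<triangleright> a)))"
    and "f \<triangleright> (h \<triangleright> (g \<triangleright> a)) = \<ominus>\<^bsub>A\<^esub> (f \<triangleright> (g \<triangleright> (h \<triangleright> a)))"
proof -
  note closed = assms actor_closed
  have "\<ominus>\<^bsub>A\<^esub> (f \<triangleright> (g \<triangleright> (h \<triangleright> a))) \<oplus>\<^bsub>A\<^esub> \<ominus>\<^bsub>A\<^esub> (g \<triangleright> (f \<triangleright> (h \<triangleright> a))) = \<zero>\<^bsub>A\<^esub>"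
    using id4[OF assms] by (simp add: word_L closed)
  then have "\<ominus>\<^bsub>A\<^esub> (\<ominus>\<^bsub>A\<^esub> (g \<triangleright> (f \<triangleright> (h \<triangleright> a)))) = \<ominus>\<^bsub>A\<^esub> (f \<triangleright> (g \<triangleright> (h \<triangleright> a)))"
    by (intro M.minus_equality) (simp_all add: closed)
  then show "g \<triangleright> (f \<triangleright> (h \<triangleright> a)) = \<ominus>\<^bsub>A\<^esub> (f \<triangleright> (g \<triangleright> (h \<triangleright> a)))"
    by (simp add: closed)
  have "\<ominus>\<^bsub>A\<^esub> (f \<triangleright> (g \<triangleright> (h \<triangleright> a))) \<oplus>\<^bsub>A\<^esub> \<ominus>\<^bsub>A\<^esub> (f \<triangleright> (h \<triangleright> (g \<triangleright> a))) = \<zero>\<^bsub>A\<^esub>"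
    using id11[OF assms(3,2,1,4)] by (simp add: word_L closed)
  then have "\<ominus>\<^bsub>A\<^esub> (\<ominus>\<^bsub>A\<^esub> (f \<triangleright> (h \<triangleright> (g \<triangleright> a)))) = \<ominus>\<^bsub>A\<^esub> (f \<triangleright> (g \<triangleright> (h \<triangleright> a)))"
    by (intro M.minus_equality) (simp_all add: closed)
  then show "f \<triangleright> (h \<triangleright> (g \<triangleright> a)) = \<ominus>\<^bsub>A\<^esub> (f \<triangleright> (g \<triangleright> (h \<triangleright> a)))"
    by (simp add: closed)
qed

text \<open>\<open>id10\<close> already speaks of words in $R$ alone and swaps the two outer
  indices. \<open>id5\<close> swaps the two inner ones in words with innermost letter $L$, which
  \<open>word_R\<close> converts.\<close>

lemma RRR_skew:
  assumes "f \<in> carrier (\<BB> F A)" "g \<in> carrier (\<BB> F A)" "h \<in> carrier (\<BB> F A)" "a \<in> carrier A"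
  shows "((a \<triangleleft> h) \<triangleleft> f) \<triangleleft> g = \<ominus>\<^bsub>A\<^esub> (((a \<triangleleft> h) \<triangleleft> g) \<triangleleft> f)"
    and "((a \<triangleleft> g) \<triangleleft> h) \<triangleleft> f = \<ominus>\<^bsub>A\<^esub> (((a \<triangleleft> h) \<triangleleft> g) \<triangleleft> f)"
proof -
  note closed = assms actor_closed
  show "((a \<triangleleft> h) \<triangleleft> f) \<triangleleft> g = \<ominus>\<^bsub>A\<^esub> (((a \<triangleleft> h) \<triangleleft> g) \<triangleleft> f)"
    using id10[OF assms] by (intro M.minus_equality[symmetric]) (simp_all add: closed)
  have "\<ominus>\<^bsub>A\<^esub> (((a \<triangleleft> h) \<triangleleft> g) \<triangleleft> f) \<oplus>\<^bsub>A\<^esub> \<ominus>\<^bsub>A\<^esub> (((a \<triangleleft> g) \<triangleleft> h) \<triangleleft> f) = \<zero>\<^bsub>A\<^esub>"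
    using id5[OF assms(3,2,1,4)] by (simp add: word_R closed)
  then have "\<ominus>\<^bsub>A\<^esub> (\<ominus>\<^bsub>A\<^esub> (((a \<triangleleft> g) \<triangleleft> h) \<triangleleft> f)) = \<ominus>\<^bsub>A\<^esub> (((a \<triangleleft> h) \<triangleleft> g) \<triangleleft> f)"
    by (intro M.minus_equality) (simp_all add: closed)
  then show "((a \<triangleleft> g) \<triangleleft> h) \<triangleleft> f = \<ominus>\<^bsub>A\<^esub> (((a \<triangleleft> h) \<triangleleft> g) \<triangleleft> f)"
    by (simp add: closed)
qed

section \<open>Triple products in the actor\<close>

lemma actor_linear: "f \<in> carrier (\<BB> F A) \<Longrightarrow> linear_pair F A f"
  using actor_carrier_linear[OF module_axioms]
  by (simp add: universal_strict_general_actor_def pair_structure_def)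

lemma actor_mult: "f \<otimes>\<^bsub>\<BB> F A\<^esub> g = pair_mult A f g"
  by (simp add: universal_strict_general_actor_def pair_structure_def)

text \<open>In the left map, $L_f(L_{gh} + R_{gh}) = L_f L_g L_h + L_f R_h R_g$ vanishes by
  skew-symmetry, and $-R_{gh} L_f$ reduces to $L_g R_h L_f$. In the right map, $R_{gh}(R_f + L_f)$
  cancels after normalisation and $-L_f R_{gh}$ leaves $-L_f L_g L_h$.\<close>

lemma right_nested_product:
  assumes "f \<in> carrier (\<BB> F A)" "g \<in> carrier (\<BB> F A)" "h \<in> carrier (\<BB> F A)" "a \<in> carrier A"
  shows "(f \<otimes>\<^bsub>\<BB> F A\<^esub> (g \<otimes>\<^bsub>\<BB> F A\<^esub> h)) \<triangleright> a = \<ominus>\<^bsub>A\<^esub> (f \<triangleright> (g \<triangleright> (h \<triangleright> a)))"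
    and "a \<triangleleft> (f \<otimes>\<^bsub>\<BB> F A\<^esub> (g \<otimes>\<^bsub>\<BB> F A\<^esub> h)) = \<ominus>\<^bsub>A\<^esub> (f \<triangleright> (g \<triangleright> (h \<triangleright> a)))"
proof -
  note simps = assms actor_mult actor_linear actor_closed pair_apply linear_pair_simps
    word_L word_R abelian_simps
  \<comment> \<open>The surviving term $L_g R_h L_f = -L_g L_h L_f$ has its indices permuted
    cyclically, which is an even permutation.\<close>
  have "g \<triangleright> (h \<triangleright> (f \<triangleright> a)) = f \<triangleright> (g \<triangleright> (h \<triangleright> a))"
    using LLL_skew(2)[OF assms(2,1,3,4)] LLL_skew(1)[OF assms]
    by (simp add: assms actor_closed)
  moreover have "f \<triangleright> (h \<triangleright> (g \<triangleright> a)) = \<ominus>\<^bsub>A\<^esub> (f \<triangleright> (g \<triangleright> (h \<triangleright> a)))"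
    by (rule LLL_skew(2)[OF assms])
  ultimately show "(f \<otimes>\<^bsub>\<BB> F A\<^esub> (g \<otimes>\<^bsub>\<BB> F A\<^esub> h)) \<triangleright> a = \<ominus>\<^bsub>A\<^esub> (f \<triangleright> (g \<triangleright> (h \<triangleright> a)))"
    by (simp add: simps)
  show "a \<triangleleft> (f \<otimes>\<^bsub>\<BB> F A\<^esub> (g \<otimes>\<^bsub>\<BB> F A\<^esub> h)) = \<ominus>\<^bsub>A\<^esub> (f \<triangleright> (g \<triangleright> (h \<triangleright> a)))"
    by (simp add: simps)
qed

text \<open>In the left map, $L_{fg}(L_h + R_h)$ cancels after normalisation and $-R_h L_{fg}$
  leaves $-R_h R_g R_f$, whose indices are reversed: an odd permutation. In the right map,
  $R_h(R_{fg} + L_{fg}) = R_h R_g R_f + R_h L_f L_g$ vanishes by skew-symmetry, and $-L_{fg} R_h$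
  leaves $-R_g R_f R_h$.\<close>

lemma left_nested_product:
  assumes "f \<in> carrier (\<BB> F A)" "g \<in> carrier (\<BB> F A)" "h \<in> carrier (\<BB> F A)" "a \<in> carrier A"
  shows "((f \<otimes>\<^bsub>\<BB> F A\<^esub> g) \<otimes>\<^bsub>\<BB> F A\<^esub> h) \<triangleright> a = ((a \<triangleleft> h) \<triangleleft> g) \<triangleleft> f"
    and "a \<triangleleft> ((f \<otimes>\<^bsub>\<BB> F A\<^esub> g) \<otimes>\<^bsub>\<BB> F A\<^esub> h) = ((a \<triangleleft> h) \<triangleleft> g) \<triangleleft> f"
proof -
  note simps = assms actor_mult actor_linear actor_closed pair_apply linear_pair_simps
    word_L word_R abelian_simps
  have gfh: "((a \<triangleleft> h) \<triangleleft> f) \<triangleleft> g = \<ominus>\<^bsub>A\<^esub> (((a \<triangleleft> h) \<triangleleft> g) \<triangleleft> f)"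
    by (rule RRR_skew(1)[OF assms])
  \<comment> \<open>Adjacent transpositions lead step by step from $R_g R_f R_h$ through $R_g R_h
    R_f$ and $R_h R_g R_f$ to $R_h R_f R_g$, alternating the sign.\<close>
  have "((a \<triangleleft> f) \<triangleleft> h) \<triangleleft> g = ((a \<triangleleft> h) \<triangleleft> g) \<triangleleft> f"
    using RRR_skew(2)[OF assms(2,1,3,4)] gfh by (simp add: assms actor_closed)
  then have hgf: "((a \<triangleleft> f) \<triangleleft> g) \<triangleleft> h = \<ominus>\<^bsub>A\<^esub> (((a \<triangleleft> h) \<triangleleft> g) \<triangleleft> f)"
    using RRR_skew(1)[OF assms(2,3,1,4)] by (simp add: assms actor_closed)
  have "((a \<triangleleft> g) \<triangleleft> f) \<triangleleft> h = ((a \<triangleleft> h) \<triangleleft> g) \<triangleleft> f"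
    using RRR_skew(2)[OF assms(3,2,1,4)] hgf by (simp add: assms actor_closed)
  note perms = gfh hgf this
  show "((f \<otimes>\<^bsub>\<BB> F A\<^esub> g) \<otimes>\<^bsub>\<BB> F A\<^esub> h) \<triangleright> a = ((a \<triangleleft> h) \<triangleleft> g) \<triangleleft> f"
    using hgf by (simp add: simps)
  show "a \<triangleleft> ((f \<otimes>\<^bsub>\<BB> F A\<^esub> g) \<otimes>\<^bsub>\<BB> F A\<^esub> h) = ((a \<triangleleft> h) \<triangleleft> g) \<triangleleft> f"
    using perms by (simp add: simps)
qed

lemma g_alternative_algebra_actor: "g_alternative_algebra F (\<BB> F A)"
proof -
  interpret B: nonassoc_algebra F "\<BB> F A"
    by (rule nonassoc_algebra_actor)
  note mult_closed = bilinear_mapD(1)[OF B.mult_bilinear]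
  have add: "f \<oplus>\<^bsub>\<BB> F A\<^esub> g = pair_add A f g" and zero: "\<zero>\<^bsub>\<BB> F A\<^esub> = pair_zero A" for f g
    by (simp_all add: universal_strict_general_actor_def pair_structure_def)
  \<comment> \<open>By the two product formulas, skew-symmetry of the operator words becomes
    skew-symmetry of both bracketings of a triple product.\<close>
  have skew: "(f \<otimes>\<^bsub>\<BB> F A\<^esub> g) \<otimes>\<^bsub>\<BB> F A\<^esub> h \<oplus>\<^bsub>\<BB> F A\<^esub> (g \<otimes>\<^bsub>\<BB> F A\<^esub> f) \<otimes>\<^bsub>\<BB> F A\<^esub> h = \<zero>\<^bsub>\<BB> F A\<^esub>"
    "(f \<otimes>\<^bsub>\<BB> F A\<^esub> g) \<otimes>\<^bsub>\<BB> F A\<^esub> h \<oplus>\<^bsub>\<BB> F A\<^esub> (f \<otimes>\<^bsub>\<BB> F A\<^esub> h) \<otimes>\<^bsub>\<BB> F A\<^esub> g = \<zero>\<^bsub>\<BB> F A\<^esub>"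
    "f \<otimes>\<^bsub>\<BB> F A\<^esub> (g \<otimes>\<^bsub>\<BB> F A\<^esub> h) \<oplus>\<^bsub>\<BB> F A\<^esub> g \<otimes>\<^bsub>\<BB> F A\<^esub> (f \<otimes>\<^bsub>\<BB> F A\<^esub> h) = \<zero>\<^bsub>\<BB> F A\<^esub>"
    "f \<otimes>\<^bsub>\<BB> F A\<^esub> (g \<otimes>\<^bsub>\<BB> F A\<^esub> h) \<oplus>\<^bsub>\<BB> F A\<^esub> f \<otimes>\<^bsub>\<BB> F A\<^esub> (h \<otimes>\<^bsub>\<BB> F A\<^esub> g) = \<zero>\<^bsub>\<BB> F A\<^esub>"
    if "f \<in> carrier (\<BB> F A)" "g \<in> carrier (\<BB> F A)" "h \<in> carrier (\<BB> F A)" for f g h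
  proof -
    note eqI = linear_pair_eqI[of F A, OF actor_linear actor_linear]
    show "(f \<otimes>\<^bsub>\<BB> F A\<^esub> g) \<otimes>\<^bsub>\<BB> F A\<^esub> h \<oplus>\<^bsub>\<BB> F A\<^esub> (g \<otimes>\<^bsub>\<BB> F A\<^esub> f) \<otimes>\<^bsub>\<BB> F A\<^esub> h = \<zero>\<^bsub>\<BB> F A\<^esub>"
      "(f \<otimes>\<^bsub>\<BB> F A\<^esub> g) \<otimes>\<^bsub>\<BB> F A\<^esub> h \<oplus>\<^bsub>\<BB> F A\<^esub> (f \<otimes>\<^bsub>\<BB> F A\<^esub> h) \<otimes>\<^bsub>\<BB> F A\<^esub> g = \<zero>\<^bsub>\<BB> F A\<^esub>"
      "f \<otimes>\<^bsub>\<BB> F A\<^esub> (g \<otimes>\<^bsub>\<BB> F A\<^esub> h) \<oplus>\<^bsub>\<BB> F A\<^esub> g \<otimes>\<^bsub>\<BB> F A\<^esub> (f \<otimes>\<^bsub>\<BB> F A\<^esub> h) = \<zero>\<^bsub>\<BB> F A\<^esub>"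
      "f \<otimes>\<^bsub>\<BB> F A\<^esub> (g \<otimes>\<^bsub>\<BB> F A\<^esub> h) \<oplus>\<^bsub>\<BB> F A\<^esub> f \<otimes>\<^bsub>\<BB> F A\<^esub> (h \<otimes>\<^bsub>\<BB> F A\<^esub> g) = \<zero>\<^bsub>\<BB> F A\<^esub>"
      \<comment> \<open>Membership in the actor is discharged first; what remains is one equation
        for each of the two maps, both being a word plus its negative.\<close>
      by (rule eqI; (simp add: that mult_closed; fail)?;
        simp add: add zero that pair_apply actor_closed left_nested_product right_nested_product
            LLL_skew[OF that] RRR_skew[OF that] M.r_neg M.l_neg)+
  qed
  \<comment> \<open>Both g-alternative identities have this shape, with $x + x' = 0$ and $y + y' =
    0$.\<close>
  have solve: "x = y \<oplus>\<^bsub>\<BB> F A\<^esub> y' \<ominus>\<^bsub>\<BB> F A\<^esub> x'"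
    if "x \<oplus>\<^bsub>\<BB> F A\<^esub> x' = \<zero>\<^bsub>\<BB> F A\<^esub>" "y \<oplus>\<^bsub>\<BB> F A\<^esub> y' = \<zero>\<^bsub>\<BB> F A\<^esub>"
      "x \<in> carrier (\<BB> F A)" "x' \<in> carrier (\<BB> F A)" for x x' y y'
    using B.M.minus_equality[OF that(1,4,3)] that by (simp add: a_minus_def)
  show ?thesis
    \<comment> \<open>The left identity takes its two vanishing sums from the third and first facts
      of \<open>skew\<close>, the right identity from the second and fourth.\<close>
    by unfold_locales (rule solve; simp add: skew mult_closed)+
qed

end

theorem theorem5p1:
  fixes F :: "('f, 'm) ring_scheme" and A :: "('f, 'a, 'n) module_scheme"
  assumes "g_alternative_algebra F A"
    and "\<And>b\<^sub>1 b\<^sub>2 b\<^sub>3 a. \<lbrakk>b\<^sub>1 \<in> carrier (\<BB> F A); b\<^sub>2 \<in> carrier (\<BB> F A); b\<^sub>3 \<in> carrier (\<BB> F A); a \<in> carrier A\<rbrakk> \<Longrightarrow>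
      b\<^sub>1 \<triangleright> (b\<^sub>2 \<triangleright> (b\<^sub>3 \<triangleright> a)) \<oplus>\<^bsub>A\<^esub> b\<^sub>1 \<triangleright> (b\<^sub>2 \<triangleright> (a \<triangleleft> b\<^sub>3)) = \<zero>\<^bsub>A\<^esub>"
    and "\<And>b\<^sub>1 b\<^sub>2 b\<^sub>3 a. \<lbrakk>b\<^sub>1 \<in> carrier (\<BB> F A); b\<^sub>2 \<in> carrier (\<BB> F A); b\<^sub>3 \<in> carrier (\<BB> F A); a \<in> carrier A\<rbrakk> \<Longrightarrow>
      b\<^sub>1 \<triangleright> ((a \<triangleleft> b\<^sub>2) \<triangleleft> b\<^sub>3) \<oplus>\<^bsub>A\<^esub> b\<^sub>1 \<triangleright> ((b\<^sub>2 \<triangleright> a) \<triangleleft> b\<^sub>3) = \<zero>\<^bsub>A\<^esub>"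
    and "\<And>b\<^sub>1 b\<^sub>2 b\<^sub>3 a. \<lbrakk>b\<^sub>1 \<in> carrier (\<BB> F A); b\<^sub>2 \<in> carrier (\<BB> F A); b\<^sub>3 \<in> carrier (\<BB> F A); a \<in> carrier A\<rbrakk> \<Longrightarrow>
      ((b\<^sub>1 \<triangleright> a) \<triangleleft> b\<^sub>2) \<triangleleft> b\<^sub>3 \<oplus>\<^bsub>A\<^esub> (b\<^sub>2 \<triangleright> (b\<^sub>1 \<triangleright> a)) \<triangleleft> b\<^sub>3 = \<zero>\<^bsub>A\<^esub>"
    and "\<And>b\<^sub>1 b\<^sub>2 b\<^sub>3 a. \<lbrakk>b\<^sub>1 \<in> carrier (\<BB> F A); b\<^sub>2 \<in> carrier (\<BB> F A); b\<^sub>3 \<in> carrier (\<BB> F A); a \<in> carrier A\<rbrakk> \<Longrightarrow>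
      b\<^sub>1 \<triangleright> (b\<^sub>2 \<triangleright> (a \<triangleleft> b\<^sub>3)) \<oplus>\<^bsub>A\<^esub> b\<^sub>2 \<triangleright> (b\<^sub>1 \<triangleright> (a \<triangleleft> b\<^sub>3)) = \<zero>\<^bsub>A\<^esub>"
    and "\<And>b\<^sub>1 b\<^sub>2 b\<^sub>3 a. \<lbrakk>b\<^sub>1 \<in> carrier (\<BB> F A); b\<^sub>2 \<in> carrier (\<BB> F A); b\<^sub>3 \<in> carrier (\<BB> F A); a \<in> carrier A\<rbrakk> \<Longrightarrow>
      ((b\<^sub>1 \<triangleright> a) \<triangleleft> b\<^sub>2) \<triangleleft> b\<^sub>3 \<oplus>\<^bsub>A\<^esub> ((b\<^sub>2 \<triangleright> a) \<triangleleft> b\<^sub>1) \<triangleleft> b\<^sub>3 = \<zero>\<^bsub>A\<^esub>"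
    and "\<And>b\<^sub>1 b\<^sub>2 b\<^sub>3 a. \<lbrakk>b\<^sub>1 \<in> carrier (\<BB> F A); b\<^sub>2 \<in> carrier (\<BB> F A); b\<^sub>3 \<in> carrier (\<BB> F A); a \<in> carrier A\<rbrakk> \<Longrightarrow>
      b\<^sub>1 \<triangleright> (b\<^sub>2 \<triangleright> (b\<^sub>3 \<triangleright> a)) \<oplus>\<^bsub>A\<^esub> b\<^sub>1 \<triangleright> ((b\<^sub>3 \<triangleright> a) \<triangleleft> b\<^sub>2) = \<zero>\<^bsub>A\<^esub>"
    and "\<And>b\<^sub>1 b\<^sub>2 b\<^sub>3 a. \<lbrakk>b\<^sub>1 \<in> carrier (\<BB> F A); b\<^sub>2 \<in> carrier (\<BB> F A); b\<^sub>3 \<in> carrier (\<BB> F A); a \<in> carrier A\<rbrakk> \<Longrightarrow>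
      b\<^sub>1 \<triangleright> (b\<^sub>2 \<triangleright> (a \<triangleleft> b\<^sub>3)) \<oplus>\<^bsub>A\<^esub> b\<^sub>1 \<triangleright> ((a \<triangleleft> b\<^sub>3) \<triangleleft> b\<^sub>2) = \<zero>\<^bsub>A\<^esub>"
    and "\<And>b\<^sub>1 b\<^sub>2 b\<^sub>3 a. \<lbrakk>b\<^sub>1 \<in> carrier (\<BB> F A); b\<^sub>2 \<in> carrier (\<BB> F A); b\<^sub>3 \<in> carrier (\<BB> F A); a \<in> carrier A\<rbrakk> \<Longrightarrow>
      (b\<^sub>1 \<triangleright> (b\<^sub>2 \<triangleright> a)) \<triangleleft> b\<^sub>3 \<oplus>\<^bsub>A\<^esub> (b\<^sub>1 \<triangleright> (a \<triangleleft> b\<^sub>2)) \<triangleleft> b\<^sub>3 = \<zero>\<^bsub>A\<^esub>"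
    and "\<And>b\<^sub>1 b\<^sub>2 b\<^sub>3 a. \<lbrakk>b\<^sub>1 \<in> carrier (\<BB> F A); b\<^sub>2 \<in> carrier (\<BB> F A); b\<^sub>3 \<in> carrier (\<BB> F A); a \<in> carrier A\<rbrakk> \<Longrightarrow>
      ((a \<triangleleft> b\<^sub>1) \<triangleleft> b\<^sub>2) \<triangleleft> b\<^sub>3 \<oplus>\<^bsub>A\<^esub> (b\<^sub>2 \<triangleright> (a \<triangleleft> b\<^sub>1)) \<triangleleft> b\<^sub>3 = \<zero>\<^bsub>A\<^esub>"
    and "\<And>b\<^sub>1 b\<^sub>2 b\<^sub>3 a. \<lbrakk>b\<^sub>1 \<in> carrier (\<BB> F A); b\<^sub>2 \<in> carrier (\<BB> F A); b\<^sub>3 \<in> carrier (\<BB> F A); a \<in> carrier A\<rbrakk> \<Longrightarrow>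
      ((a \<triangleleft> b\<^sub>3) \<triangleleft> b\<^sub>1) \<triangleleft> b\<^sub>2 \<oplus>\<^bsub>A\<^esub> ((a \<triangleleft> b\<^sub>3) \<triangleleft> b\<^sub>2) \<triangleleft> b\<^sub>1 = \<zero>\<^bsub>A\<^esub>"
    and "\<And>b\<^sub>1 b\<^sub>2 b\<^sub>3 a. \<lbrakk>b\<^sub>1 \<in> carrier (\<BB> F A); b\<^sub>2 \<in> carrier (\<BB> F A); b\<^sub>3 \<in> carrier (\<BB> F A); a \<in> carrier A\<rbrakk> \<Longrightarrow>
      b\<^sub>3 \<triangleright> (b\<^sub>2 \<triangleright> (a \<triangleleft> b\<^sub>1)) \<oplus>\<^bsub>A\<^esub> b\<^sub>3 \<triangleright> (b\<^sub>1 \<triangleright> (a \<triangleleft> b\<^sub>2)) = \<zero>\<^bsub>A\<^esub>"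
  shows "g_alternative_algebra F (\<BB> F A)"
proof -
  interpret actor_identities F A
    by (intro actor_identities.intro actor_identities_axioms.intro assms)
  show ?thesis
    by (rule g_alternative_algebra_actor)
qed

end
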